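(* Let $\mathfrak{g}$ be of type $C_n$. For $i,j\in I=\{1,2,\dots,n\}$, $$(1+z^{2n+2})\,\widetilde C_{ij}(z)=\begin{cases}\sum_{s=1}^{\min(i,j)}\bigl(z^{|i-j|+2s-1}+z^{2n-i-j+2s+1}\bigr)&\text{if }i,j<n,\\ \sum_{s=1}^{i}\bigl(z^{n-1-i+2s}+z^{n+1-i+2s}\bigr)&\text{if }i<n,\ j=n,\\ \sum_{s=1}^{j}z^{n-j+2s}&\text{if }i=n,\ j<n,\\ \sum_{s=1}^{n}z^{2s}&\text{if }i=j=n.\end{cases}$$
   Context: Type $C_n$ ($n\ge2$): label the Dynkin nodes $I=\{1,\dots,n\}$ along the chain, with $n$ the node of the long simple root. Put $(d_1,\dots,d_n)=(1,\dots,1,2)$. The Cartan matrix $(c_{ij})$ has $c_{ii}=2$, $c_{ij}=0$ if $|i-j|>1$, $c_{n-1,n}=-2$, and all other $c_{ij}$ with $|i-j|=1$ equal to $-1$ (in particular $c_{n,n-1}=-1$). The quantum Cartan matrix is $C(z)=(C_{ij}(z))_{i,j\in I}$ with $C_{ii}(z)=z^{d_i}+z^{-d_i}$ and $C_{ij}(z)=[c_{ij}]_z$ for $i\ne j$, where $[k]_z=(z^k-z^{-k})/(z-z^{-1})$ (so $[-1]_z=-1$, $[-2]_z=-(z+z^{-1})$). It is invertible over $\mathbb{Q}(z)$, and $\widetilde C(z)=(\widetilde C_{ij}(z))_{i,j\in I}=C(z)^{-1}$. *)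

theory Defs
  imports
    Complex_Main
    "HOL-Computational_Algebra.Polynomial"
    "HOL-Computational_Algebra.Fraction_Field"
    "Jordan_Normal_Form.Matrix"
    "Jordan_Normal_Form.Gauss_Jordan_Elimination"
begin

text \<open>The field of rational functions over the rationals, as the fraction field of the
  polynomial ring, and its indeterminate.\<close>

type_synonym ratfun = "rat poly fract"

definition zvar :: ratfun where
  "zvar = Fract [:0, 1:] 1"

definition qint :: "int \<Rightarrow> ratfun" where
  "qint k = (zvar powi k - zvar powi (- k)) / (zvar - zvar powi (- 1))"

text \<open>Type \<open>C\<^sub>n\<close> data. Nodes are the natural numbers 1 to \<open>n\<close>, and \<open>n\<close> is the node of the
  long simple root; the functions below are meaningful for indices in that range only.\<close>

definition dC :: "nat \<Rightarrow> nat \<Rightarrow> int" where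
  "dC n i = (if i = n then 2 else 1)"

definition cartanC :: "nat \<Rightarrow> nat \<Rightarrow> nat \<Rightarrow> int" where
  "cartanC n i j =
    (if i = j then 2
     else if \<bar>int i - int j\<bar> > 1 then 0
     else if i = n - 1 \<and> j = n then - 2
     else - 1)"

definition qcartanC :: "nat \<Rightarrow> nat \<Rightarrow> nat \<Rightarrow> ratfun" where
  "qcartanC n i j =
    (if i = j then zvar powi (dC n i) + zvar powi (- dC n i)
     else qint (cartanC n i j))"

text \<open>Matrices are indexed from 0, so node \<open>i\<close> is row (or column) \<open>i - 1\<close>.\<close>

definition qcartan_matC :: "nat \<Rightarrow> ratfun mat" where
  "qcartan_matC n = mat n n (\<lambda>(a, b). qcartanC n (Suc a) (Suc b))"

text \<open>Since \<^term>\<open>the None\<close> is unspecified, entries of the inverse are only determined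
  once the matrix is known to be invertible.\<close>

definition inv_qcartanC :: "nat \<Rightarrow> nat \<Rightarrow> nat \<Rightarrow> ratfun" where
  "inv_qcartanC n i j = the (mat_inverse (qcartan_matC n)) $$ (i - 1, j - 1)"

end

theory Submission
  imports Defs "Jordan_Normal_Form.Determinant"
begin

text \<open>
  Write \<open>[k] = z\<^sup>k - z\<^sup>-\<^sup>k\<close>. Summing the geometric progressions turns the right-hand side into
  \<open>[min i j] (z\<^sup>m + z\<^sup>2\<^sup>n\<^sup>+\<^sup>2\<^sup>-\<^sup>m) / [1]\<close> with \<open>m = max i j\<close>, divided by \<open>z + z\<^sup>-\<^sup>1\<close> when
  \<open>i = n\<close>. For fixed \<open>j\<close> the undivided kernel is a discrete Green function: both of its factors
  solve \<open>(z + z\<^sup>-\<^sup>1) u\<^sub>i = u\<^sub>i\<^sub>-\<^sub>1 + u\<^sub>i\<^sub>+\<^sub>1\<close>, the first vanishes at 0, the second satisfies the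
  boundary condition at \<open>n\<close>, and their Wronskian is \<open>[1] (1 + z\<^sup>2\<^sup>n\<^sup>+\<^sup>2)\<close>.
\<close>

section \<open>Green function of the recurrence and its boundary condition at the last node\<close>

definition green :: "'a::field \<Rightarrow> nat \<Rightarrow> nat \<Rightarrow> nat \<Rightarrow> 'a" where
  "green z n i j = (z powi int (min i j) - z powi (- int (min i j))) *
     (z powi int (max i j) + z powi (2 * int n + 2 - int (max i j)))"

lemma green_0 [simp]: "green z n 0 j = 0"
  by (simp add: green_def)

text \<open>Natural exponents separate the variables, so later identities become rational ones in
  \<open>z ^ i\<close>, \<open>z ^ j\<close> and the constant \<open>z powi (2 * int n + 2)\<close>.
  On the diagonal both branch formulas apply.\<close>

lemma green_le:
  fixes z :: "'a::field"
  assumes "z \<noteq> 0" and "i \<le> j"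
  shows "green z n i j = (z ^ i - inverse (z ^ i)) * (z ^ j + z powi (2 * int n + 2) / z ^ j)"
  using assms
  by (simp add: green_def min_absorb1 max_absorb2 power_int_minus power_int_diff)

lemma green_ge:
  fixes z :: "'a::field"
  assumes "z \<noteq> 0" and "j \<le> i"
  shows "green z n i j = (z ^ j - inverse (z ^ j)) * (z ^ i + z powi (2 * int n + 2) / z ^ i)"
  using assms
  by (simp add: green_def min_absorb2 max_absorb1 power_int_minus power_int_diff)

text \<open>Off the diagonal the three nodes lie on one branch, whose varying factor solves the
  homogeneous recurrence; at \<open>Suc k = j\<close> the branches meet and their Wronskian
  remains.\<close>

lemma green_recurrence:
  fixes z :: "'a::field"
  assumes z: "z \<noteq> 0"
  shows "(z + inverse z) * green z n (Suc k) j - green z n k j - green z n (Suc (Suc k)) j =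
    (if Suc k = j then (z - inverse z) * (1 + z powi (2 * int n + 2)) else 0)"
proof -
  define w where "w = z powi (2 * int n + 2)"
  define x where "x = z ^ k"
  define y where "y = z ^ j"
  have nz: "x \<noteq> 0" "y \<noteq> 0" using z by (simp_all add: x_def y_def)
  consider "j = Suc k" | "Suc k < j" | "j < Suc k" by linarith
  then show ?thesis
  proof cases
    case 1
    have "(z + inverse z) * ((z * x - inverse (z * x)) * (z * x + w / (z * x)))
        - (x - inverse x) * (z * x + w / (z * x))
        - (z * x - inverse (z * x)) * (z * (z * x) + w / (z * (z * x)))
        = (z - inverse z) * (1 + w)"
      using z nz by (simp add: field_simps)
    with 1 show ?thesis
      using z by (simp add: green_le green_ge flip: x_def w_def)
  next
    case 2
    have "(z + inverse z) * ((z * x - inverse (z * x)) * (y + w / y))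
        - (x - inverse x) * (y + w / y)
        - (z * (z * x) - inverse (z * (z * x))) * (y + w / y) = 0"
      using z nz by (simp add: field_simps)
    with 2 show ?thesis
      using z by (simp add: green_le flip: x_def y_def w_def)
  next
    case 3
    have "(z + inverse z) * ((y - inverse y) * (z * x + w / (z * x)))
        - (y - inverse y) * (x + w / x)
        - (y - inverse y) * (z * (z * x) + w / (z * (z * x))) = 0"
      using z nz by (simp add: field_simps)
    with 3 show ?thesis
      using z by (simp add: green_ge flip: x_def y_def w_def)
  qed
qed

text \<open>For \<open>j \<le> n\<close> only the second factor varies. It is symmetric about the
  node \<open>n + 1\<close>, so the recurrence there has equal values at both neighbours.\<close>

lemma green_boundary:
  fixes z :: "'a::field"
  assumes z: "z \<noteq> 0" and "j \<le> n"
  shows "(z + inverse z) * green z n (Suc n) j = 2 * green z n n j"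
proof -
  have "z powi (1 + int n) = z powi int n * z" "z powi (2 + int n) = z powi int n * z * z"
    using z power_int_add[of z "int n" 2] by (simp_all add: power_int_add power2_eq_square mult_ac)
  with assms show ?thesis
    by (simp add: green_def min_absorb2 max_absorb1 field_simps del: power_int_of_nat)
qed

text \<open>The corner entry is the square of \<open>z + inverse z\<close> minus 2. The boundary
  condition absorbs the 2 and leaves the generic recurrence at \<open>n\<close>, with a fictitious
  node \<open>n + 1\<close>.\<close>

lemma green_last_row:
  fixes z :: "'a::field"
  assumes z: "z \<noteq> 0" and d: "z + inverse z \<noteq> 0" and n: "n \<ge> 1" and j: "j \<le> n"
  shows "(z ^ 2 + inverse z ^ 2) * (green z n n j / (z + inverse z)) - green z n (n - 1) j =
    (if n = j then (z - inverse z) * (1 + z powi (2 * int n + 2)) else 0)"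
proof -
  have 1: "green z n (Suc n) j = 2 * green z n n j / (z + inverse z)"
    using green_boundary[OF z j] d by (simp add: field_simps)
  have "z ^ 2 + inverse z ^ 2 = (z + inverse z) * (z + inverse z) - 2"
    using z by (simp add: power2_eq_square algebra_simps)
  then have "(z ^ 2 + inverse z ^ 2) * (green z n n j / (z + inverse z)) =
      (z + inverse z) * green z n n j - green z n (Suc n) j"
    using d unfolding 1 by (simp add: left_diff_distrib diff_divide_distrib)
  with green_recurrence[OF z, of n "n - 1" j] n show ?thesis by (simp add: algebra_simps)
qed

text \<open>The factor \<open>z - inverse z\<close> makes the sum telescope; the midpoint of the two
  surviving exponents is then factored out.\<close>

lemma geometric_sum_powi:
  fixes z :: "'a::field"
  assumes "z \<noteq> 0"
  shows "(\<Sum>s = 1..m. z powi (a + 2 * int s)) * (z - inverse z) =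
    z powi (a + int m + 1) * (z powi int m - z powi (- int m))"
proof -
  have step: "z powi (a + 2 * int s) * (z - inverse z) =
      z powi (a + 2 * int s + 1) - z powi (a + 2 * int s - 1)" for s
    using assms by (simp add: power_int_add power_int_diff field_simps)
  have "(\<Sum>s = 1..m. z powi (a + 2 * int s)) * (z - inverse z) =
      z powi (a + 2 * int m + 1) - z powi (a + 1)"
  proof (induction m)
    case (Suc m)
    then show ?case using step[of "Suc m"] by (simp add: distrib_right add_ac del: of_nat_Suc)
       (simp add: algebra_simps)
  qed simp
  also have "\<dots> = z powi (a + int m + 1) * (z powi int m - z powi (- int m))"
    unfolding right_diff_distrib using assms
    by (simp add: power_int_add[symmetric] add_ac del: power_int_of_nat)
  finally show ?thesis .
qed

section \<open>Nonvanishing scalars in the field of rational functions\<close>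

lemma zvar_power: "zvar ^ k = Fract (monom 1 k) 1"
  by (induction k) (simp_all add: zvar_def One_fract_def monom_Suc monom_0 mult.commute flip: one_pCons)

lemma zvar_nonzero: "zvar \<noteq> 0"
  by (simp add: zvar_def Zero_fract_def eq_fract)

text \<open>Used with \<open>k = 2\<close> for \<open>zvar + inverse zvar\<close>, and with
  \<open>k = 2 * n + 2\<close> for the scalar in front of the inverse.\<close>

lemma one_plus_zvar_power_nonzero:
  assumes "k > 0"
  shows "1 + zvar ^ k \<noteq> 0"
proof
  assume "1 + zvar ^ k = 0"
  then have "1 + monom 1 k = (0 :: rat poly)"
    unfolding zvar_power by (simp add: One_fract_def Zero_fract_def eq_fract)
  then have "coeff (1 + monom 1 k :: rat poly) k = 0" by simp
  with assms show False by simp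
qed

lemma zvar_power_neq_one:
  assumes "k > 0"
  shows "zvar ^ k \<noteq> 1"
proof
  assume "zvar ^ k = 1"
  then have "monom 1 k = (1 :: rat poly)"
    unfolding zvar_power by (simp add: One_fract_def eq_fract)
  then have "coeff (monom 1 k :: rat poly) k = coeff 1 k" by simp
  with assms show False by simp
qed

lemma zvar_plus_inverse_nonzero: "zvar + inverse zvar \<noteq> 0"
  using one_plus_zvar_power_nonzero[of 2] zvar_nonzero
  by (auto simp: field_simps power2_eq_square add_ac)

lemma zvar_minus_inverse_nonzero: "zvar - inverse zvar \<noteq> 0"
  using zvar_power_neq_one[of 2] zvar_nonzero
  by (auto simp: field_simps power2_eq_square)

section \<open>Rows of the quantum Cartan matrix\<close>

lemma qint_0: "qint 0 = 0"
  by (simp add: qint_def)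

lemma qint_minus_1: "qint (- 1) = - 1"
  using zvar_minus_inverse_nonzero by (simp add: qint_def divide_simps)

lemma qint_minus_2: "qint (- 2) = - (zvar + inverse zvar)"
proof -
  have "zvar powi (- 2) - zvar powi 2 = - (zvar + inverse zvar) * (zvar - inverse zvar)"
    using zvar_nonzero by (simp add: power_int_minus power2_eq_square field_simps)
  then show ?thesis
    using zvar_minus_inverse_nonzero by (simp add: qint_def)
qed

text \<open>Written with three indicator terms, so that a row sum collapses to at most three
  summands.\<close>

lemma qcartanC_tridiagonal:
  "qcartanC n (Suc a) k =
    (if k = Suc a then if Suc a = n then zvar ^ 2 + inverse zvar ^ 2 else zvar + inverse zvar else 0)
    + (if k = a then - 1 else 0)
    + (if k = Suc (Suc a) then if Suc (Suc a) = n then - (zvar + inverse zvar) else - 1 else 0)"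
  by (auto simp: qcartanC_def cartanC_def dC_def qint_0 qint_minus_1 qint_minus_2 power_int_minus
      power_inverse)

text \<open>Candidate for the inverse times \<open>1 + zvar powi (2 * int n + 2)\<close>. The
  division in row \<open>n\<close> cancels the matrix entry \<open>- (zvar + inverse zvar)\<close>
  in column \<open>n\<close>.\<close>

definition scaled_invC :: "nat \<Rightarrow> nat \<Rightarrow> nat \<Rightarrow> ratfun" where
  "scaled_invC n i j = green zvar n i j / (zvar - inverse zvar) /
     (if i = n then zvar + inverse zvar else 1)"

text \<open>After multiplication by \<open>zvar - inverse zvar\<close>, the last row is
  \<open>green_last_row\<close> and every other row is \<open>green_recurrence\<close>.\<close>

lemma qcartanC_scaled_invC:
  assumes a: "a < n" and j: "j \<le> n"
  shows "(\<Sum>k = 1..n. qcartanC n (Suc a) k * scaled_invC n k j) =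
    (if Suc a = j then 1 + zvar powi (2 * int n + 2) else 0)"
proof -
  note nz = zvar_nonzero zvar_minus_inverse_nonzero zvar_plus_inverse_nonzero
  let ?f = "\<lambda>k. scaled_invC n k j" and ?d = "zvar - inverse zvar" and ?p = "zvar + inverse zvar"
  have row: "(\<Sum>k = 1..n. qcartanC n (Suc a) k * ?f k) =
      (if Suc a = n then zvar ^ 2 + inverse zvar ^ 2 else ?p) * ?f (Suc a) - ?f a
      + (if Suc (Suc a) \<le> n then (if Suc (Suc a) = n then - ?p else - 1) * ?f (Suc (Suc a)) else 0)"
  proof -
    \<comment> \<open>For \<open>a = 0\<close> the sum has no term at node 0; the zero boundary
      value lets the first row share the general formula.\<close>
    have "?f a = 0" if "\<not> Suc 0 \<le> a" using that by (simp add: scaled_invC_def not_le)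
    then show ?thesis using a
      by (simp add: qcartanC_tridiagonal distrib_right sum.distrib if_distrib[of "\<lambda>x. x * _"]
          sum.delta cong: if_cong)
  qed
  show ?thesis
  proof (cases "Suc a = n")
    case True
    then have "?d * (\<Sum>k = 1..n. qcartanC n (Suc a) k * ?f k) =
        (zvar ^ 2 + inverse zvar ^ 2) * (green zvar n n j / ?p) - green zvar n (n - 1) j"
      using nz(2) unfolding row by (auto simp: scaled_invC_def right_diff_distrib)
    then show ?thesis
      using green_last_row[OF nz(1,3), of n j] True j nz(2) by (auto split: if_splits)
  next
    case False
    then have "?d * (\<Sum>k = 1..n. qcartanC n (Suc a) k * ?f k) =
        ?p * green zvar n (Suc a) j - green zvar n a j - green zvar n (Suc (Suc a)) j"
      using nz(2,3) a unfolding row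
      by (auto simp: scaled_invC_def right_diff_distrib distrib_left simp del: minus_add_distrib)
    then show ?thesis
      using green_recurrence[OF nz(1), of n a j] nz(2) by (auto split: if_splits)
  qed
qed

section \<open>From a right inverse to the entries of the inverse matrix\<close>

text \<open>A right inverse of a square matrix over a field is two-sided, which rules out
  \<open>None\<close>; uniqueness of inverses does the rest.\<close>

lemma the_mat_inverse_eq:
  fixes A B :: "'a::field mat"
  assumes A: "A \<in> carrier_mat n n" and B: "B \<in> carrier_mat n n" and AB: "A * B = 1\<^sub>m n"
  shows "the (mat_inverse A) = B"
proof (cases "mat_inverse A")
  case None
  have "B * A = 1\<^sub>m n" using mat_mult_left_right_inverse[OF A B AB] .
  then have "A \<in> Units (ring_mat TYPE('a) n ())"
    using A B AB by (auto simp: Units_def ring_mat_simps)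
  with mat_inverse(1)[OF A None, of "()"] show ?thesis by simp
next
  case (Some X)
  note X = mat_inverse(2)[OF A Some]
  then have "X = X * (A * B)" using AB right_mult_one_mat[of X n n] by simp
  also have "\<dots> = B" using X assoc_mult_mat[of X n n A n B n] A B by simp
  finally show ?thesis using Some by simp
qed

lemma inv_qcartanC_eq:
  assumes "i \<in> {1..n}" and "j \<in> {1..n}"
  shows "(1 + zvar powi (2 * int n + 2)) * inv_qcartanC n i j = scaled_invC n i j"
proof -
  let ?c = "1 + zvar powi (2 * int n + 2)"
  have "zvar powi (2 * int n + 2) = zvar ^ (2 * n + 2)"
    using power_int_of_nat[of zvar "2 * n + 2"] by (simp add: add.commute)
  then have c: "?c \<noteq> 0" using one_plus_zvar_power_nonzero[of "2 * n + 2"] by simp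
  define B where "B = mat n n (\<lambda>(a, b). scaled_invC n (Suc a) (Suc b) / ?c)"
  have "qcartan_matC n * B = 1\<^sub>m n"
  proof (rule eq_matI)
    fix a b assume "a < dim_row (1\<^sub>m n :: ratfun mat)" "b < dim_col (1\<^sub>m n :: ratfun mat)"
    then have ab: "a < n" "b < n" by simp_all
    have "(qcartan_matC n * B) $$ (a, b) =
        (\<Sum>k<n. qcartanC n (Suc a) (Suc k) * scaled_invC n (Suc k) (Suc b)) / ?c"
      using ab by (simp add: qcartan_matC_def B_def scalar_prod_def sum_divide_distrib
          atLeast0LessThan)
    also have "(\<Sum>k<n. qcartanC n (Suc a) (Suc k) * scaled_invC n (Suc k) (Suc b)) =
        (\<Sum>k = 1..n. qcartanC n (Suc a) k * scaled_invC n k (Suc b))"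
      by (rule sum.reindex_bij_witness[of _ "\<lambda>k. k - 1" Suc]) auto
    also have "\<dots> = (if a = b then ?c else 0)"
      using qcartanC_scaled_invC[of a n "Suc b"] ab by simp
    finally show "(qcartan_matC n * B) $$ (a, b) = 1\<^sub>m n $$ (a, b)"
      using ab c by simp
  qed (simp_all add: qcartan_matC_def B_def)
  then have "the (mat_inverse (qcartan_matC n)) = B"
    by (intro the_mat_inverse_eq[of _ n]) (simp_all add: qcartan_matC_def B_def)
  then show ?thesis using assms c by (auto simp: inv_qcartanC_def B_def)
qed

theorem theorem3p16:
  fixes n i j :: nat
  assumes "n \<ge> 2" and "i \<in> {1..n}" and "j \<in> {1..n}"
  shows "(1 + zvar powi (2 * int n + 2)) * inv_qcartanC n i j =
    (if i < n \<and> j < n then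
       (\<Sum>s = 1..min i j. zvar powi (\<bar>int i - int j\<bar> + 2 * int s - 1)
                       + zvar powi (2 * int n - int i - int j + 2 * int s + 1))
     else if i < n \<and> j = n then
       (\<Sum>s = 1..i. zvar powi (int n - 1 - int i + 2 * int s)
                 + zvar powi (int n + 1 - int i + 2 * int s))
     else if i = n \<and> j < n then
       (\<Sum>s = 1..j. zvar powi (int n - int j + 2 * int s))
     else
       (\<Sum>s = 1..n. zvar powi (2 * int s)))"
proof -
  note nz = zvar_nonzero zvar_minus_inverse_nonzero zvar_plus_inverse_nonzero
  define S where "S m a = (\<Sum>s = 1..m. zvar powi (a + 2 * int s))" for m a
  have S: "S m a = zvar powi (a + int m + 1) * (zvar powi int m - zvar powi (- int m)) /
      (zvar - inverse zvar)" for m a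
    using geometric_sum_powi[OF nz(1), of a m] nz(2)
    by (simp add: S_def eq_divide_eq del: right_minus_eq)
  have "zvar powi (int n + 2) = zvar powi (int n + 1) * zvar"
    "zvar powi int n = zvar powi (int n + 1) * inverse zvar"
    using nz(1) power_int_add[of zvar "int n + 1" 1] by (simp_all add: power_int_add)
  \<comment> \<open>This factor \<open>zvar + inverse zvar\<close> cancels the division in row
    \<open>n\<close>, leaving one geometric sum there instead of two.\<close>
  then have wn: "zvar powi int n + zvar powi (int n + 2) =
      zvar powi (int n + 1) * (zvar + inverse zvar)"
    by (simp add: algebra_simps)
  have generic: "scaled_invC n i j =
      S (min i j) (\<bar>int i - int j\<bar> - 1) + S (min i j) (2 * int n - int i - int j + 1)"
    if "i < n"
  proof -
    \<comment> \<open>The two offsets make the exponent \<open>a + int m + 1\<close> in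
      \<open>S\<close> equal to the two exponents in the second factor of
      \<open>green\<close>.\<close>
    have "\<bar>int i - int j\<bar> - 1 + int (min i j) + 1 = int (max i j)"
      "2 * int n - int i - int j + 1 + int (min i j) + 1 = 2 * int n + 2 - int (max i j)"
      by linarith+
    with that show ?thesis
      by (simp only: scaled_invC_def green_def S)
        (simp add: ring_distribs add_divide_distrib diff_divide_distrib mult_ac)
  qed
  have last: "scaled_invC n n j = S j (int n - int j)"
  proof -
    have "green zvar n n j = (zvar powi int j - zvar powi (- int j)) *
        (zvar powi int n + zvar powi (int n + 2))"
      using assms by (simp add: green_def min_absorb2 max_absorb1 add_ac)
    then show ?thesis using nz(3) unfolding wn scaled_invC_def S by (simp add: mult_ac)
  qed
  consider "i < n" "j < n" | "i < n" "j = n" | "i = n" using assms by force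
  then show ?thesis
  proof cases
    case 1
    then show ?thesis
      unfolding inv_qcartanC_eq[OF assms(2,3)] generic[OF 1(1)]
      by (simp add: S_def sum.distrib algebra_simps)
  next
    case 2
    then show ?thesis
      unfolding inv_qcartanC_eq[OF assms(2,3)] generic[OF 2(1)]
      by (simp add: S_def sum.distrib algebra_simps)
  next
    case 3
    \<comment> \<open>\<open>last\<close> also covers \<open>j = n\<close>, where the offset
      \<open>int n - int j\<close> is 0.\<close>
    then show ?thesis
      using inv_qcartanC_eq[OF assms(2,3)] last assms by (auto simp: S_def)
  qed
qed

end
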